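(* Let $\mathbf Z=G_z(\boldsymbol\theta_0,\mathbf U)$ and let $\widehat\Theta=\widehat\Theta(\mathbf Z)\subset\Theta$ be a (data-dependent) candidate set satisfying $\mathbb P\{\boldsymbol\theta_0\in\widehat\Theta(\mathbf Z)\}=1-o(\delta')$. Let $$\Gamma'_\alpha(\mathbf z)=\{\boldsymbol\theta\in\widehat\Theta(\mathbf z):\exists\,\mathbf u^*\in\mathcal U\text{ such that }\mathbf z=G_z(\boldsymbol\theta,\mathbf u^* ),\ T(\mathbf u^*,\boldsymbol\theta)\in B_\alpha(\boldsymbol\theta)\}.$$ Then $\mathbb P\{\boldsymbol\theta_0\in\Gamma'_\alpha(\mathbf Z)\}\ge\alpha-o(\delta')$.
   Context: $\Theta$ is an arbitrary parameter set with true parameter $\boldsymbol\theta_0\in\Theta$; $\mathbf U$ is a random vector in $\mathcal U\subset\mathbb R^r$ with known distribution; $G_z:\Theta\times\mathcal U\to\mathcal Z$ is a known mapping; $T:\mathcal U\times\Theta\to\mathcal T\subseteq\mathbb R^q$ is a given function and $B_\alpha(\boldsymbol\theta)$, $0<\alpha<1$, are Borel sets satisfying $\mathbb P\{T(\mathbf U,\boldsymbol\theta)\in B_\alpha(\boldsymbol\theta)\}\ge\alpha$ for all $\boldsymbol\theta\in\Theta$. $\delta'>0$ is a small number (possibly depending on the sample size); $o(\delta')$ denotes a quantity which, divided by $\delta'$, tends to $0$ as $\delta'\to0$. Measurability of events is implicit. *)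

theory Defs
  imports "HOL-Probability.Probability" "HOL-Library.Landau_Symbols"
begin

text \<open>
  Euclidean space of dimension \<open>n\<close> with its Borel sigma-algebra. The dimension is a term, not a
  type, so that it may vary along a family of models (for instance with the sample size).
\<close>

abbreviation Rvec :: "nat \<Rightarrow> (nat \<Rightarrow> real) measure" where
  "Rvec n \<equiv> (\<Pi>\<^sub>M j\<in>{..<n}. (borel :: real measure))"

text \<open>
  The sets \<open>\<Theta>\<close> and \<open>\<Z>\<close> carry no structure. Neither \<open>T\<close> nor \<open>G\<close> is required to be measurable;
  the coverage events are.
\<close>

locale repro_model = prob_space M
  for M :: "'w measure" +
  fixes \<Theta> :: "'p set"
    and \<theta>\<^sub>0 :: 'p
    and r :: nat
    and \<U> :: "(nat \<Rightarrow> real) set"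
    and U :: "'w \<Rightarrow> nat \<Rightarrow> real"
    and \<Z> :: "'z set"
    and G :: "'p \<Rightarrow> (nat \<Rightarrow> real) \<Rightarrow> 'z"
    and q :: nat
    and \<T> :: "(nat \<Rightarrow> real) set"
    and T :: "(nat \<Rightarrow> real) \<Rightarrow> 'p \<Rightarrow> nat \<Rightarrow> real"
    and B :: "real \<Rightarrow> 'p \<Rightarrow> (nat \<Rightarrow> real) set"
  assumes true_param: "\<theta>\<^sub>0 \<in> \<Theta>"
    and \<U>_subset: "\<U> \<subseteq> space (Rvec r)"
    and U_random_vector: "random_variable (Rvec r) U"
    and U_in: "\<And>\<omega>. \<omega> \<in> space M \<Longrightarrow> U \<omega> \<in> \<U>"
    and G_in: "\<And>\<theta> u. \<theta> \<in> \<Theta> \<Longrightarrow> u \<in> \<U> \<Longrightarrow> G \<theta> u \<in> \<Z>"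
    and \<T>_subset: "\<T> \<subseteq> space (Rvec q)"
    and T_in: "\<And>u \<theta>. u \<in> \<U> \<Longrightarrow> \<theta> \<in> \<Theta> \<Longrightarrow> T u \<theta> \<in> \<T>"
    and B_borel: "\<And>\<alpha> \<theta>. 0 < \<alpha> \<Longrightarrow> \<alpha> < 1 \<Longrightarrow> \<theta> \<in> \<Theta> \<Longrightarrow> B \<alpha> \<theta> \<in> sets (Rvec q)"
    and coverage_event: "\<And>\<alpha> \<theta>. 0 < \<alpha> \<Longrightarrow> \<alpha> < 1 \<Longrightarrow> \<theta> \<in> \<Theta> \<Longrightarrow>
          {\<omega> \<in> space M. T (U \<omega>) \<theta> \<in> B \<alpha> \<theta>} \<in> events"
    and coverage: "\<And>\<alpha> \<theta>. 0 < \<alpha> \<Longrightarrow> \<alpha> < 1 \<Longrightarrow> \<theta> \<in> \<Theta> \<Longrightarrow>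
          \<P>(\<omega> in M. T (U \<omega>) \<theta> \<in> B \<alpha> \<theta>) \<ge> \<alpha>"

definition candidate_confidence_set ::
  "'u set \<Rightarrow> ('p \<Rightarrow> 'u \<Rightarrow> 'z) \<Rightarrow> ('u \<Rightarrow> 'p \<Rightarrow> 't) \<Rightarrow> (real \<Rightarrow> 'p \<Rightarrow> 't set) \<Rightarrow> ('z \<Rightarrow> 'p set)
    \<Rightarrow> real \<Rightarrow> 'z \<Rightarrow> 'p set" where
  "candidate_confidence_set \<U> G T B \<Theta>hat \<alpha> z =
     {\<theta> \<in> \<Theta>hat z. \<exists>u\<in>\<U>. z = G \<theta> u \<and> T u \<theta> \<in> B \<alpha> \<theta>}"

end

theory Submission imports Defs begin

text \<open>The data are generated by \<open>U\<close> itself, so \<open>U \<omega>\<close> is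
  always a solution of the equation \<open>Z \<omega> = G \<theta>\<^sub>0 u\<close>. Hence the true
  parameter can drop out of the confidence set only if
  \<open>T (U \<omega>) \<theta>\<^sub>0\<close> falls outside
  \<open>B \<alpha> \<theta>\<^sub>0\<close>, which has probability at most 1 - \<alpha>, or if the
  candidate set misses \<open>\<theta>\<^sub>0\<close>. Both events depend on the same
  \<open>U\<close>, so they are combined by the Bonferroni bound \<open>prob_Int_ge\<close>, which
  holds under any dependence. This gives \<open>prob_candidate_confidence_set_ge\<close>, whose
  error term is the miss probability, assumed to be o(\<delta>).\<close>

lemma (in prob_space) prob_Int_ge:
  assumes "A \<in> events" "C \<in> events"
  shows "prob (A \<inter> C) \<ge> prob A + prob C - 1"
proof -
  have "prob (A \<union> C) = prob A + prob C - prob (A \<inter> C)"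
    using assms by (intro measure_Un3) (auto simp: fmeasurable_eq_sets)
  then show ?thesis
    using prob_le_1[of "A \<union> C"] by linarith
qed

text \<open>Exact form for a single model, with no limit involved: passing to candidates costs at
  most the probability that they miss \<open>\<theta>\<^sub>0\<close>. Having the error explicit
  lets the bound be used at each index of a family.\<close>

lemma (in repro_model) prob_candidate_confidence_set_ge:
  assumes \<alpha>: "0 < \<alpha>" "\<alpha> < 1"
    and Z: "\<And>\<omega>. \<omega> \<in> space M \<Longrightarrow> Z \<omega> = G \<theta>\<^sub>0 (U \<omega>)"
    and candidate: "{\<omega> \<in> space M. \<theta>\<^sub>0 \<in> \<Theta>hat (Z \<omega>)} \<in> events"
    and confidence: "{\<omega> \<in> space M. \<theta>\<^sub>0 \<in> candidate_confidence_set \<U> G T B \<Theta>hat \<alpha> (Z \<omega>)} \<in> events"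
  shows "\<P>(\<omega> in M. \<theta>\<^sub>0 \<in> candidate_confidence_set \<U> G T B \<Theta>hat \<alpha> (Z \<omega>))
           \<ge> \<alpha> - (1 - \<P>(\<omega> in M. \<theta>\<^sub>0 \<in> \<Theta>hat (Z \<omega>)))"
proof -
  let ?A = "{\<omega> \<in> space M. T (U \<omega>) \<theta>\<^sub>0 \<in> B \<alpha> \<theta>\<^sub>0}"
  let ?C = "{\<omega> \<in> space M. \<theta>\<^sub>0 \<in> \<Theta>hat (Z \<omega>)}"
  have "\<alpha> - (1 - prob ?C) \<le> prob ?A + prob ?C - 1"
    using coverage[OF \<alpha> true_param] by simp
  also have "\<dots> \<le> prob (?A \<inter> ?C)"
    using coverage_event[OF \<alpha> true_param] candidate by (rule prob_Int_ge)
  also have "\<dots> \<le> \<P>(\<omega> in M. \<theta>\<^sub>0 \<in> candidate_confidence_set \<U> G T B \<Theta>hat \<alpha> (Z \<omega>))"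
    \<comment> \<open>on the event \<open>?A \<inter> ?C\<close> the required \<open>u\<close> is \<open>U \<omega>\<close> itself\<close>
    using Z U_in confidence
    by (intro finite_measure_mono) (auto simp: candidate_confidence_set_def)
  finally show ?thesis .
qed

theorem corollary3:
  fixes F :: "'i filter"
    and \<delta> :: "'i \<Rightarrow> real"
    and M :: "'i \<Rightarrow> 'w measure"
    and \<Theta> :: "'i \<Rightarrow> 'p set"
    and \<theta>\<^sub>0 :: "'i \<Rightarrow> 'p"
    and r q :: "'i \<Rightarrow> nat"
    and \<U> \<T> :: "'i \<Rightarrow> (nat \<Rightarrow> real) set"
    and U :: "'i \<Rightarrow> 'w \<Rightarrow> nat \<Rightarrow> real"
    and \<Z> :: "'i \<Rightarrow> 'z set"
    and G :: "'i \<Rightarrow> 'p \<Rightarrow> (nat \<Rightarrow> real) \<Rightarrow> 'z"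
    and T :: "'i \<Rightarrow> (nat \<Rightarrow> real) \<Rightarrow> 'p \<Rightarrow> nat \<Rightarrow> real"
    and B :: "'i \<Rightarrow> real \<Rightarrow> 'p \<Rightarrow> (nat \<Rightarrow> real) set"
    and Z :: "'i \<Rightarrow> 'w \<Rightarrow> 'z"
    and \<Theta>hat :: "'i \<Rightarrow> 'z \<Rightarrow> 'p set"
    and \<alpha> :: real
  assumes \<delta>_pos: "\<And>i. \<delta> i > 0"
    and \<delta>_small: "(\<delta> \<longlongrightarrow> 0) F"
    and model: "\<And>i. repro_model (M i) (\<Theta> i) (\<theta>\<^sub>0 i) (r i) (\<U> i) (U i) (\<Z> i) (G i)
                        (q i) (\<T> i) (T i) (B i)"
    and Z: "\<And>i \<omega>. \<omega> \<in> space (M i) \<Longrightarrow> Z i \<omega> = G i (\<theta>\<^sub>0 i) (U i \<omega>)"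
    and candidate_subset: "\<And>i z. z \<in> \<Z> i \<Longrightarrow> \<Theta>hat i z \<subseteq> \<Theta> i"
    and candidate_event: "\<And>i. {\<omega> \<in> space (M i). \<theta>\<^sub>0 i \<in> \<Theta>hat i (Z i \<omega>)} \<in> sets (M i)"
    and candidate_prob: "(\<lambda>i. 1 - \<P>(\<omega> in M i. \<theta>\<^sub>0 i \<in> \<Theta>hat i (Z i \<omega>))) \<in> o[F](\<delta>)"
    and \<alpha>: "0 < \<alpha>" "\<alpha> < 1"
    and confidence_event: "\<And>i. {\<omega> \<in> space (M i). \<theta>\<^sub>0 i \<in>
           candidate_confidence_set (\<U> i) (G i) (T i) (B i) (\<Theta>hat i) \<alpha> (Z i \<omega>)} \<in> sets (M i)"
  shows "\<exists>\<epsilon>. \<epsilon> \<in> o[F](\<delta>) \<and>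
           (\<forall>i. \<P>(\<omega> in M i. \<theta>\<^sub>0 i \<in>
             candidate_confidence_set (\<U> i) (G i) (T i) (B i) (\<Theta>hat i) \<alpha> (Z i \<omega>)) \<ge> \<alpha> - \<epsilon> i)"
  \<comment> \<open>The witness for \<open>\<epsilon>\<close> is the miss probability of the
    candidate set at each \<open>i\<close>. It is o(\<delta>) by \<open>candidate_prob\<close>, and
    the bound holds at every index, not just eventually along \<open>F\<close>.\<close>
  using candidate_prob
    repro_model.prob_candidate_confidence_set_ge[OF model \<alpha> Z candidate_event confidence_event]
  by blast

end
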